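(* Let $F$ be a tract (equipped with an involution) that is strongly fused, i.e. satisfies the following axiom (SF): whenever $\alpha,\beta,\gamma\in\mathbb{N}[F^\times]$ are such that $\alpha+\gamma\in N_F$ and $\beta-\gamma\in N_F$, and either $\gamma=0$ or $\gamma\notin N_F$, then $\alpha+\beta\in N_F$. Then $F$ is perfect.
   Context: For an abelian group $G$, $\mathbb{N}[G]$ is the group semiring (finite formal sums of elements of $G$ with coefficients in $\mathbb{N}=\{0,1,2,\dots\}$). A tract is a multiplicatively written commutative monoid $F$ with an absorbing element $0$ such that $F^\times:=F\setminus\{0\}$ is a group, together with a subset $N_F\subseteq\mathbb{N}[F^\times]$ (the null set) such that: (T1) the zero element of $\mathbb{N}[F^\times]$ belongs to $N_F$; (T2) there is a unique $\epsilon\in F^\times$ with $1+\epsilon\in N_F$; (T3) $N_F$ is closed under the natural action of $F^\times$ on $\mathbb{N}[F^\times]$. One writes $-1$ for $\epsilon$, $-\alpha$ for $\epsilon\alpha$ and $\alpha-\beta$ for $\alpha+\epsilon\beta$ ($\alpha,\beta\in\mathbb{N}[F^\times]$); $x-x$ is not the zero element of $\mathbb{N}[F^\times]$. $F$ is regarded as a subset of $\mathbb{N}[F^\times]$, with $0\in F$ identified with the zero of $\mathbb{N}[F^\times]$. A morphism of tracts $\varphi:F\to F'$ is a map with $\varphi(0)=0$, inducing a group homomorphism $F^\times\to(F')^\times$, and with (its additive extension satisfying) $\varphi(N_F)\subseteq N_{F'}$. Tracts are endowed with an involution $x\mapsto\bar x$, i.e. a morphism $F\to F$ whose square is the identity (possibly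 the identity itself); it is extended additively to $\mathbb{N}[F^\times]$. Let $E$ be a finite set. For $X,Y\in\mathbb{N}[F^\times]^E$ put $X\cdot Y:=\sum_{e\in E}X(e)\overline{Y(e)}\in\mathbb{N}[F^\times]$, and write $X\perp Y$ ($X$ is orthogonal to $Y$) if $X\cdot Y\in N_F$; for sets $S,T$, $S\perp T$ means $X\perp Y$ for all $X\in S$, $Y\in T$. The support of $X$ is $\underline{X}=\{e\in E: X(e)\neq 0\}$. Let $\underline{M}$ be an ordinary matroid on $E$. An $F$-signature of $\underline{M}$ is a subset $C\subseteq F^E$ such that (C0) $0\notin C$; (C1) if $X\in C$ and $\alpha\in F^\times$ then $\alpha X\in C$; (C2) taking supports gives a bijection from the projectivization $C/F^\times$ to the set of circuits of $\underline{M}$. A dual pair of $F$-signatures of $\underline M$ is a pair $(C,D)$ with $C$ an $F$-signature of $\underline{M}$, $D$ an $F$-signature of the dual matroid $\underline{M}^*$, and $C\perp D$. A (strong) $F$-matroid $M$ on $E$ is a matroid $\underline{M}$ on $E$ together with a dual pair $(C(M),C^*(M))$ of $F$-signatures of $\underline{M}$; the elements of $C(M)$ and $C^*(M)$ are the $F$-circuits and $F$-cocircuits of $M$. A vector of $M$ is an $X\in F^E$ with $X\perp Y$ for all $Y\in C^*(M)$; a covector of $M$ is an $X\in F^E$ with $X\perp Y$ for all $Y\in C(M)$. The sets of vectors and covectors are $V(M)$ and $V^*(M)$. The tract $F$ is perfect if $V(M)\perp V^*(M)$ for every $F$-matroid $M$. *)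

theory Defs
  imports "HOL-Algebra.Group" "HOL-Library.Multiset" "HOL-Library.FuncSet"
begin

section \<open>Tracts\<close>

text \<open>
  The additive monoid of the group semiring \<open>\<nat>[G]\<close> (finite formal sums of elements of
  \<open>G\<close> with coefficients in \<open>\<nat>\<close>) is the set of finite multisets over \<open>G\<close>: the empty multiset
  is the zero element and multiset union is addition.
\<close>

record 'a tract = "'a monoid" +
  tzero :: 'a
  nullset :: "'a multiset set"

definition nonzeros :: "'a tract \<Rightarrow> 'a set" where
  "nonzeros F = carrier F - {tzero F}"

definition mult_group :: "'a tract \<Rightarrow> 'a tract" where
  "mult_group F = F\<lparr>carrier := nonzeros F\<rparr>"

definition formal_sums :: "'a tract \<Rightarrow> 'a multiset set" where
  "formal_sums F = {\<alpha>. set_mset \<alpha> \<subseteq> nonzeros F}"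

definition act :: "'a tract \<Rightarrow> 'a \<Rightarrow> 'a multiset \<Rightarrow> 'a multiset" where
  "act F c \<alpha> = image_mset (\<lambda>x. c \<otimes>\<^bsub>F\<^esub> x) \<alpha>"

locale tract = comm_monoid F for F :: "'a tract" (structure) +
  assumes tzero_closed: "tzero F \<in> carrier F"
    and tzero_absorbing: "x \<in> carrier F \<Longrightarrow> x \<otimes> tzero F = tzero F"
    and nonzeros_group: "group (mult_group F)"
    and nullset_subset: "nullset F \<subseteq> formal_sums F"
    and T1: "{#} \<in> nullset F"
    and T2: "\<exists>!\<epsilon>. \<epsilon> \<in> nonzeros F \<and> {#\<one>, \<epsilon>#} \<in> nullset F"
    and T3: "c \<in> nonzeros F \<Longrightarrow> \<alpha> \<in> nullset F \<Longrightarrow> act F c \<alpha> \<in> nullset F"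

definition minus_one :: "'a tract \<Rightarrow> 'a" where
  "minus_one F = (THE \<epsilon>. \<epsilon> \<in> nonzeros F \<and> {#\<one>\<^bsub>F\<^esub>, \<epsilon>#} \<in> nullset F)"

text \<open>The formal difference \<open>\<alpha> + \<epsilon>\<beta>\<close>, not to be confused with multiset difference.\<close>

definition formal_minus :: "'a tract \<Rightarrow> 'a multiset \<Rightarrow> 'a multiset \<Rightarrow> 'a multiset" where
  "formal_minus F \<alpha> \<beta> = \<alpha> + act F (minus_one F) \<beta>"

definition tract_morphism :: "'a tract \<Rightarrow> 'b tract \<Rightarrow> ('a \<Rightarrow> 'b) \<Rightarrow> bool" where
  "tract_morphism F F' \<phi> \<longleftrightarrow>
     \<phi> (tzero F) = tzero F' \<and>
     \<phi> \<in> hom (mult_group F) (mult_group F') \<and>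
     (\<forall>\<alpha>\<in>nullset F. image_mset \<phi> \<alpha> \<in> nullset F')"

definition tract_involution :: "'a tract \<Rightarrow> ('a \<Rightarrow> 'a) \<Rightarrow> bool" where
  "tract_involution F bar \<longleftrightarrow>
     tract_morphism F F bar \<and> (\<forall>x\<in>carrier F. bar (bar x) = x)"

definition strongly_fused :: "'a tract \<Rightarrow> bool" where
  "strongly_fused F \<longleftrightarrow>
     (\<forall>\<alpha>\<in>formal_sums F. \<forall>\<beta>\<in>formal_sums F. \<forall>\<gamma>\<in>formal_sums F.
        \<alpha> + \<gamma> \<in> nullset F \<and> formal_minus F \<beta> \<gamma> \<in> nullset F \<and>
        (\<gamma> = {#} \<or> \<gamma> \<notin> nullset F) \<longrightarrow> \<alpha> + \<beta> \<in> nullset F)"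


section \<open>Orthogonality\<close>

text \<open>
  Elements of \<open>F\<^sup>E\<close> are the extensional functions \<open>E \<rightarrow>\<^sub>E carrier F\<close>.
  An element of \<open>F\<close> is viewed as a formal sum, \<open>0 \<in> F\<close> being the empty sum.
\<close>

definition formal :: "'a tract \<Rightarrow> 'a \<Rightarrow> 'a multiset" where
  "formal F x = (if x = tzero F then {#} else {#x#})"

definition dot :: "'a tract \<Rightarrow> ('a \<Rightarrow> 'a) \<Rightarrow> 'e set \<Rightarrow> ('e \<Rightarrow> 'a) \<Rightarrow> ('e \<Rightarrow> 'a) \<Rightarrow> 'a multiset" where
  "dot F bar E X Y = (\<Sum>e\<in>E. formal F (X e \<otimes>\<^bsub>F\<^esub> bar (Y e)))"

definition orthogonal ::
    "'a tract \<Rightarrow> ('a \<Rightarrow> 'a) \<Rightarrow> 'e set \<Rightarrow> ('e \<Rightarrow> 'a) \<Rightarrow> ('e \<Rightarrow> 'a) \<Rightarrow> bool" where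
  "orthogonal F bar E X Y \<longleftrightarrow> dot F bar E X Y \<in> nullset F"

definition orthogonal_sets ::
    "'a tract \<Rightarrow> ('a \<Rightarrow> 'a) \<Rightarrow> 'e set \<Rightarrow> ('e \<Rightarrow> 'a) set \<Rightarrow> ('e \<Rightarrow> 'a) set \<Rightarrow> bool" where
  "orthogonal_sets F bar E S T \<longleftrightarrow> (\<forall>X\<in>S. \<forall>Y\<in>T. orthogonal F bar E X Y)"

definition supp :: "'a tract \<Rightarrow> 'e set \<Rightarrow> ('e \<Rightarrow> 'a) \<Rightarrow> 'e set" where
  "supp F E X = {e \<in> E. X e \<noteq> tzero F}"

definition scale :: "'a tract \<Rightarrow> 'e set \<Rightarrow> 'a \<Rightarrow> ('e \<Rightarrow> 'a) \<Rightarrow> ('e \<Rightarrow> 'a)" where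
  "scale F E c X = (\<lambda>e\<in>E. c \<otimes>\<^bsub>F\<^esub> X e)"


section \<open>Ordinary matroids\<close>

locale matroid =
  fixes E :: "'e set" and indep :: "'e set set"
  assumes finite_ground: "finite E"
    and indep_subset: "I \<in> indep \<Longrightarrow> I \<subseteq> E"
    and empty_indep: "{} \<in> indep"
    and indep_hereditary: "I \<in> indep \<Longrightarrow> J \<subseteq> I \<Longrightarrow> J \<in> indep"
    and indep_augment: "I \<in> indep \<Longrightarrow> J \<in> indep \<Longrightarrow> card I < card J \<Longrightarrow>
                          \<exists>x\<in>J - I. insert x I \<in> indep"

definition circuits :: "'e set \<Rightarrow> 'e set set \<Rightarrow> 'e set set" where
  "circuits E indep = {K. K \<subseteq> E \<and> K \<notin> indep \<and> (\<forall>J. J \<subset> K \<longrightarrow> J \<in> indep)}"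

definition bases :: "'e set set \<Rightarrow> 'e set set" where
  "bases indep = {B \<in> indep. \<forall>I\<in>indep. B \<subseteq> I \<longrightarrow> I = B}"

text \<open>The independent sets of the dual matroid, whose bases are the complements of bases.\<close>

definition dual_indep :: "'e set \<Rightarrow> 'e set set \<Rightarrow> 'e set set" where
  "dual_indep E indep = {I. \<exists>B\<in>bases indep. I \<subseteq> E - B}"


section \<open>Matroids over a tract\<close>

definition projectivization :: "'a tract \<Rightarrow> 'e set \<Rightarrow> ('e \<Rightarrow> 'a) set \<Rightarrow> ('e \<Rightarrow> 'a) set set" where
  "projectivization F E C = (\<lambda>X. (\<lambda>c. scale F E c X) ` nonzeros F) ` C"

text \<open>
  The support is constant on each class \<open>P\<close> of the projectivization, so the induced map sends
  \<open>P\<close> to the only element of the image of \<open>P\<close> under \<^const>\<open>supp\<close>.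
\<close>

definition F_signature ::
    "'a tract \<Rightarrow> 'e set \<Rightarrow> 'e set set \<Rightarrow> ('e \<Rightarrow> 'a) set \<Rightarrow> bool" where
  "F_signature F E indep C \<longleftrightarrow>
     C \<subseteq> (E \<rightarrow>\<^sub>E carrier F) \<and>
     (\<lambda>e\<in>E. tzero F) \<notin> C \<and>
     (\<forall>X\<in>C. \<forall>c\<in>nonzeros F. scale F E c X \<in> C) \<and>
     bij_betw (\<lambda>P. the_elem (supp F E ` P)) (projectivization F E C) (circuits E indep)"

definition dual_pair ::
    "'a tract \<Rightarrow> ('a \<Rightarrow> 'a) \<Rightarrow> 'e set \<Rightarrow> 'e set set \<Rightarrow> ('e \<Rightarrow> 'a) set \<Rightarrow> ('e \<Rightarrow> 'a) set \<Rightarrow> bool" where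
  "dual_pair F bar E indep C D \<longleftrightarrow>
     F_signature F E indep C \<and> F_signature F E (dual_indep E indep) D \<and>
     orthogonal_sets F bar E C D"

record ('a, 'e) F_matroid =
  ground :: "'e set"
  independents :: "'e set set"
  F_circuits :: "('e \<Rightarrow> 'a) set"
  F_cocircuits :: "('e \<Rightarrow> 'a) set"

definition F_matroid :: "'a tract \<Rightarrow> ('a \<Rightarrow> 'a) \<Rightarrow> ('a, 'e) F_matroid \<Rightarrow> bool" where
  "F_matroid F bar M \<longleftrightarrow>
     matroid (ground M) (independents M) \<and>
     dual_pair F bar (ground M) (independents M) (F_circuits M) (F_cocircuits M)"

definition vectors :: "'a tract \<Rightarrow> ('a \<Rightarrow> 'a) \<Rightarrow> ('a, 'e) F_matroid \<Rightarrow> ('e \<Rightarrow> 'a) set" where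
  "vectors F bar M =
     {X \<in> ground M \<rightarrow>\<^sub>E carrier F. \<forall>Y\<in>F_cocircuits M. orthogonal F bar (ground M) X Y}"

definition covectors :: "'a tract \<Rightarrow> ('a \<Rightarrow> 'a) \<Rightarrow> ('a, 'e) F_matroid \<Rightarrow> ('e \<Rightarrow> 'a) set" where
  "covectors F bar M =
     {X \<in> ground M \<rightarrow>\<^sub>E carrier F. \<forall>Y\<in>F_circuits M. orthogonal F bar (ground M) X Y}"

text \<open>
  A definition cannot quantify over the type \<open>'e\<close> containing the ground sets, so it is passed as
  an argument. Perfection of \<open>F\<close> is \<open>perfect TYPE('e) F bar\<close> for every type \<open>'e\<close>, equivalently
  for any one infinite type.
\<close>

definition perfect :: "'e itself \<Rightarrow> 'a tract \<Rightarrow> ('a \<Rightarrow> 'a) \<Rightarrow> bool" where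
  "perfect _ F bar \<longleftrightarrow>
     (\<forall>M :: ('a, 'e) F_matroid. F_matroid F bar M \<longrightarrow>
        orthogonal_sets F bar (ground M) (vectors F bar M) (covectors F bar M))"

end

theory Submission
  imports Defs
begin

text \<open>
  Let \<open>X\<close> be a vector and \<open>Y\<close> a covector, the latter with formal sums as values, and induct on
  the support of \<open>X\<close>. If some cocircuit \<open>D\<close> and some \<open>b\<close> with \<open>D(b) = 1\<close> are such that
  \<open>\<gamma> = \<Sum>\<^bsub>e \<noteq> b\<^esub> X(e) D(e)\<close> is not null, then subtracting multiples of \<open>D\<close> from \<open>Y\<close> clears \<open>Y(b)\<close>
  one term at a time; fusing along \<open>\<gamma>\<close> restores the original pairing, and once \<open>Y(b)\<close> is empty,
  \<open>b\<close> can be contracted. If there is no such \<open>D\<close>, setting any single coordinate of \<open>X\<close> to zero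
  gives another vector, so both \<open>X \<cdot> D\<close> and \<open>X \<cdot> Y\<close> are families of terms in which leaving out any
  one term gives a null sum. For \<open>X \<cdot> D\<close> this forces \<open>1 + 1 - 1\<close> to be null, and then it makes
  the full sum \<open>X \<cdot> Y\<close> null.
\<close>

section \<open>Matroids\<close>

context matroid
begin

lemma finite_indep: "I \<in> indep \<Longrightarrow> finite I"
  using indep_subset finite_ground finite_subset by blast

lemma circuit_in_dependent:
  assumes "K \<subseteq> E" "K \<notin> indep"
  obtains L where "L \<subseteq> K" "L \<in> circuits E indep"
proof -
  have "finite K" using assms(1) finite_ground finite_subset by blast
  then have "\<exists>L\<subseteq>K. L \<in> circuits E indep"
    using assms
  proof (induction K rule: finite_psubset_induct)
    case (psubset K)
    show ?case
    proof (cases "\<exists>J. J \<subset> K \<and> J \<notin> indep")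
      case True
      then show ?thesis using psubset by (meson order_trans psubset_imp_subset)
    next
      case False
      then show ?thesis using psubset.prems by (auto simp: circuits_def)
    qed
  qed
  then show ?thesis using that by blast
qed

lemma maximal_indep_in:
  assumes "I \<in> indep" "I \<subseteq> A"
  obtains B where "I \<subseteq> B" "B \<subseteq> A" "B \<in> indep"
    "\<And>L. L \<in> indep \<Longrightarrow> B \<subseteq> L \<Longrightarrow> L \<subseteq> A \<Longrightarrow> L = B"
proof -
  let ?P = "\<lambda>B. I \<subseteq> B \<and> B \<subseteq> A \<and> B \<in> indep"
  have "?P I" using assms by simp
  moreover have "\<forall>B. ?P B \<longrightarrow> card B < Suc (card E)"
    using indep_subset finite_ground card_mono by (metis le_imp_less_Suc)
  ultimately obtain B where B: "?P B" "\<And>L. ?P L \<Longrightarrow> card L \<le> card B"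
    using ex_has_greatest_nat[of ?P I card] by metis
  moreover have "L = B" if "L \<in> indep" "B \<subseteq> L" "L \<subseteq> A" for L
    using B that card_seteq[of L B] finite_indep by (metis order_trans)
  ultimately show ?thesis using that by blast
qed

lemma indep_extends_to_basis:
  assumes "I \<in> indep"
  obtains B where "I \<subseteq> B" "B \<in> bases indep"
  using maximal_indep_in[OF assms indep_subset[OF assms]] indep_subset
  by (smt (verit, best) bases_def mem_Collect_eq)

lemma basis_iff_card:
  assumes "B \<in> bases indep"
  shows "I \<in> bases indep \<longleftrightarrow> I \<in> indep \<and> card I = card B"
proof -
  have le: "card L \<le> card B'" if L: "B' \<in> bases indep" "L \<in> indep" for L B'
  proof (rule ccontr)
    assume "\<not> card L \<le> card B'"
    then have "card B' < card L" by simp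
    moreover have "B' \<in> indep" using L(1) by (simp add: bases_def)
    ultimately obtain x where "x \<in> L - B'" "insert x B' \<in> indep"
      using indep_augment L(2) by blast
    then show False using L(1) by (auto simp: bases_def)
  qed
  show ?thesis
  proof
    assume "I \<in> bases indep"
    then show "I \<in> indep \<and> card I = card B"
      using le assms by (simp add: bases_def order_antisym)
  next
    assume I: "I \<in> indep \<and> card I = card B"
    have "L = I" if "L \<in> indep" "I \<subseteq> L" for L
      using le[OF assms that(1)] I that card_seteq[OF finite_indep[OF that(1)] that(2)] by simp
    then show "I \<in> bases indep" using I by (auto simp: bases_def)
  qed
qed

text \<open>The set is the complement of the closure of \<open>B - {e}\<close>. Every basis meets
  it, by augmenting \<open>B - {e}\<close>, so it is codependent. A proper subset misses some
  \<open>f\<close> of it, and then lies in the complement of the basis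
  \<open>insert f (B - {e})\<close>.\<close>

lemma fundamental_cocircuit:
  assumes B: "B \<in> bases indep" and e: "e \<in> B"
  shows "{f \<in> E - (B - {e}). insert f (B - {e}) \<in> indep} \<in> circuits E (dual_indep E indep)"
    (is "?D \<in> _")
proof -
  let ?I = "B - {e}"
  have B': "B \<in> indep" "finite B" using B finite_indep by (auto simp: bases_def)
  have I: "?I \<in> indep" "card ?I < card B"
    using indep_hereditary[OF B'(1), of ?I] card_Diff1_less[OF B'(2) e] by auto
  have "?D \<notin> dual_indep E indep"
  proof
    assume "?D \<in> dual_indep E indep"
    then obtain B2 where B2: "B2 \<in> bases indep" "?D \<subseteq> E - B2" by (auto simp: dual_indep_def)
    then have "B2 \<in> indep" "card B2 = card B" using basis_iff_card[OF B] by auto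
    then obtain f where "f \<in> B2 - ?I" "insert f ?I \<in> indep" using indep_augment[OF I(1)] I(2) by metis
    then show False using B2 indep_subset by blast
  qed
  moreover have "L \<in> dual_indep E indep" if L: "L \<subset> ?D" for L
  proof -
    obtain f where f: "f \<in> ?D" "f \<notin> L" using L by blast
    have "card (insert f ?I) = card B" using f B' e card_Suc_Diff1[OF B'(2) e] by simp
    then have "insert f ?I \<in> bases indep" using f basis_iff_card[OF B] by simp
    moreover have "L \<subseteq> E - insert f ?I" using L f by blast
    ultimately show ?thesis by (auto simp: dual_indep_def)
  qed
  ultimately show ?thesis by (auto simp: circuits_def)
qed

text \<open>If \<open>e\<close> lies in the closure of \<open>J\<close>, it forms a circuit with
  elements of \<open>J\<close>. Otherwise a maximal independent subset of \<open>J\<close> together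
  with \<open>e\<close> extends to a basis, whose fundamental cocircuit at \<open>e\<close> avoids
  \<open>J\<close> by maximality. This supplies the \<open>dichotomy\<close> assumption of
  \<open>null_pairing\<close>.\<close>

lemma circuit_or_cocircuit_through:
  assumes J: "J \<subseteq> E" and e: "e \<in> E - J"
  shows "(\<exists>K\<in>circuits E indep. e \<in> K \<and> K \<subseteq> insert e J) \<or>
    (\<exists>D\<in>circuits E (dual_indep E indep). e \<in> D \<and> D \<inter> J = {})"
proof -
  obtain I where I: "I \<subseteq> J" "I \<in> indep"
    and max: "\<And>L. L \<in> indep \<Longrightarrow> I \<subseteq> L \<Longrightarrow> L \<subseteq> J \<Longrightarrow> L = I"
    using maximal_indep_in[OF empty_indep] by (metis empty_subsetI)
  show ?thesis
  proof (cases "insert e I \<in> indep")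
    case False
    then obtain K where K: "K \<subseteq> insert e I" "K \<in> circuits E indep"
      using circuit_in_dependent[of "insert e I"] J I e by blast
    then have "\<not> K \<subseteq> I" using indep_hereditary[OF I(2)] by (auto simp: circuits_def)
    then have "e \<in> K" using K(1) by blast
    then show ?thesis using K I(1) by blast
  next
    case True
    then obtain B where B: "insert e I \<subseteq> B" "B \<in> bases indep" using indep_extends_to_basis by blast
    have "f \<notin> J" if f: "f \<notin> B - {e}" "insert f (B - {e}) \<in> indep" for f
    proof
      assume "f \<in> J"
      have IB: "I \<subseteq> B - {e}" using B(1) I(1) e by blast
      then have "insert f I \<in> indep" by (intro indep_hereditary[OF f(2)]) blast
      then have "insert f I = I" using max[of "insert f I"] I(1) \<open>f \<in> J\<close> by blast
      then show False using f(1) IB by blast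
    qed
    moreover have "insert e (B - {e}) \<in> indep" using B by (auto simp: bases_def insert_absorb)
    ultimately show ?thesis
      using fundamental_cocircuit[OF B(2), of e] B(1) e by (intro disjI2 bexI) auto
  qed
qed

end

section \<open>Arithmetic of formal sums\<close>

context tract
begin

abbreviation N where "N \<equiv> nullset F"
abbreviation sums where "sums \<equiv> formal_sums F"

text \<open>Multiplication of the group semiring. As \<open>{#}\<close> is its zero, absorption by
  zero requires no case split.\<close>

definition prod_sum :: "'a multiset \<Rightarrow> 'a multiset \<Rightarrow> 'a multiset" (infixl "\<odot>" 70) where
  "\<alpha> \<odot> \<beta> = (\<Sum>x\<in>#\<alpha>. act F x \<beta>)"

definition neg :: "'a multiset \<Rightarrow> 'a multiset" where
  "neg \<alpha> = {#minus_one F#} \<odot> \<alpha>"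

text \<open>The copy of the tract inside its formal sums: zero becomes \<open>{#}\<close>, a nonzero
  element a singleton.\<close>

definition atoms :: "'a multiset set" where
  "atoms = {\<alpha> \<in> sums. size \<alpha> \<le> 1}"

lemma nonzeros_carrier: "x \<in> nonzeros F \<Longrightarrow> x \<in> carrier F"
  by (simp add: nonzeros_def)

lemma nonzeros_mult [simp]: "x \<in> nonzeros F \<Longrightarrow> y \<in> nonzeros F \<Longrightarrow> x \<otimes> y \<in> nonzeros F"
  using monoid.m_closed[OF group.is_monoid[OF nonzeros_group], of x y]
  by (simp add: mult_group_def)

lemma nonzeros_one [simp]: "\<one> \<in> nonzeros F"
  using monoid.one_closed[OF group.is_monoid[OF nonzeros_group]]
  by (simp add: mult_group_def)

lemma nonzeros_inv:
  assumes "x \<in> nonzeros F"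
  obtains y where "y \<in> nonzeros F" "y \<otimes> x = \<one>"
  using group.l_inv_ex[OF nonzeros_group, of x] assms
  by (auto simp: mult_group_def)

lemma minus_one_nonzero [simp]: "minus_one F \<in> nonzeros F"
  and minus_one_null: "{#\<one>, minus_one F#} \<in> N"
  using theI'[OF T2] by (auto simp: minus_one_def)

lemma minus_one_unique: "e \<in> nonzeros F \<Longrightarrow> {#\<one>, e#} \<in> N \<Longrightarrow> e = minus_one F"
  using T2 minus_one_nonzero minus_one_null by blast

text \<open>Multiplying the null sum \<one> + \<epsilon> by the inverse of \<epsilon> gives another
  null sum containing \<one>, so the uniqueness in \<open>T2\<close> makes \<epsilon> its own
  inverse.\<close>

lemma minus_one_squared: "minus_one F \<otimes> minus_one F = \<one>"
proof -
  obtain y where y: "y \<in> nonzeros F" "y \<otimes> minus_one F = \<one>"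
    using nonzeros_inv minus_one_nonzero by blast
  have "act F y {#\<one>, minus_one F#} \<in> N"
    using T3 minus_one_null y(1) by blast
  then have "{#\<one>, y#} \<in> N"
    using y by (simp add: act_def nonzeros_carrier add_mset_commute)
  then show ?thesis
    using minus_one_unique y by blast
qed

lemma sums_add [simp]: "\<alpha> + \<beta> \<in> sums \<longleftrightarrow> \<alpha> \<in> sums \<and> \<beta> \<in> sums"
  by (auto simp: formal_sums_def)

lemma sums_empty [simp]: "{#} \<in> sums"
  by (simp add: formal_sums_def)

lemma sums_add_mset [simp]: "add_mset x \<alpha> \<in> sums \<longleftrightarrow> x \<in> nonzeros F \<and> \<alpha> \<in> sums"
  by (auto simp: formal_sums_def)

lemma sums_sum [simp]: "(\<And>i. i \<in> I \<Longrightarrow> f i \<in> sums) \<Longrightarrow> (\<Sum>i\<in>I. f i) \<in> sums"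
  by (induction I rule: infinite_finite_induct) auto

lemma null_sums: "\<alpha> \<in> N \<Longrightarrow> \<alpha> \<in> sums"
  using nullset_subset by blast

lemma act_sums [simp]: "x \<in> nonzeros F \<Longrightarrow> \<alpha> \<in> sums \<Longrightarrow> act F x \<alpha> \<in> sums"
  by (auto simp: act_def formal_sums_def)

lemma act_act:
  "x \<in> nonzeros F \<Longrightarrow> y \<in> nonzeros F \<Longrightarrow> \<alpha> \<in> sums \<Longrightarrow> act F x (act F y \<alpha>) = act F (x \<otimes> y) \<alpha>"
  by (induction \<alpha>) (auto simp: act_def m_assoc nonzeros_carrier)

lemma act_add: "act F x (\<alpha> + \<beta>) = act F x \<alpha> + act F x \<beta>"
  by (simp add: act_def)

lemma prod_empty [simp]: "{#} \<odot> \<alpha> = {#}" "\<alpha> \<odot> {#} = {#}"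
  by (induction \<alpha>) (auto simp: prod_sum_def act_def)

lemma prod_add_mset: "add_mset x \<alpha> \<odot> \<beta> = act F x \<beta> + \<alpha> \<odot> \<beta>"
  by (simp add: prod_sum_def)

lemma prod_single: "{#x#} \<odot> \<beta> = act F x \<beta>"
  by (simp add: prod_sum_def)

lemma prod_add_left: "(\<alpha> + \<beta>) \<odot> \<gamma> = \<alpha> \<odot> \<gamma> + \<beta> \<odot> \<gamma>"
  by (simp add: prod_sum_def)

lemma prod_add_right: "\<alpha> \<odot> (\<beta> + \<gamma>) = \<alpha> \<odot> \<beta> + \<alpha> \<odot> \<gamma>"
  by (simp add: prod_sum_def act_add sum_mset.distrib)

lemma prod_sums [simp]: "\<alpha> \<in> sums \<Longrightarrow> \<beta> \<in> sums \<Longrightarrow> \<alpha> \<odot> \<beta> \<in> sums"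
  by (induction \<alpha>) (auto simp: prod_add_mset)

lemma prod_comm: "\<alpha> \<in> sums \<Longrightarrow> \<beta> \<in> sums \<Longrightarrow> \<alpha> \<odot> \<beta> = \<beta> \<odot> \<alpha>"
proof (induction \<alpha>)
  case (add x \<alpha>)
  have "\<beta> \<odot> {#x#} = act F x \<beta>"
    using \<open>\<beta> \<in> sums\<close> add.prems
    by (induction \<beta>) (auto simp: prod_add_mset act_def m_comm nonzeros_carrier)
  then show ?case
    using add prod_add_right[of \<beta> "{#x#}" \<alpha>] by (simp add: prod_add_mset)
qed simp

lemma act_prod:
  "x \<in> nonzeros F \<Longrightarrow> \<alpha> \<in> sums \<Longrightarrow> \<beta> \<in> sums \<Longrightarrow> act F x \<alpha> \<odot> \<beta> = act F x (\<alpha> \<odot> \<beta>)"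
proof (induction \<alpha>)
  case (add y \<alpha>)
  have "act F x (add_mset y \<alpha>) = add_mset (x \<otimes> y) (act F x \<alpha>)"
    by (simp add: act_def)
  then show ?case
    using add by (simp add: prod_add_mset act_add act_act)
qed (simp add: act_def)

lemma prod_assoc:
  "\<alpha> \<in> sums \<Longrightarrow> \<beta> \<in> sums \<Longrightarrow> \<gamma> \<in> sums \<Longrightarrow> (\<alpha> \<odot> \<beta>) \<odot> \<gamma> = \<alpha> \<odot> (\<beta> \<odot> \<gamma>)"
  by (induction \<alpha>) (auto simp: prod_add_mset prod_add_left act_prod)

lemma prod_left_comm:
  "\<alpha> \<in> sums \<Longrightarrow> \<beta> \<in> sums \<Longrightarrow> \<gamma> \<in> sums \<Longrightarrow> \<alpha> \<odot> (\<beta> \<odot> \<gamma>) = \<beta> \<odot> (\<alpha> \<odot> \<gamma>)"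
  by (metis prod_assoc prod_comm)

lemma act_one: "\<alpha> \<in> sums \<Longrightarrow> act F \<one> \<alpha> = \<alpha>"
  by (induction \<alpha>) (auto simp: act_def nonzeros_carrier)

lemma prod_one: "\<alpha> \<in> sums \<Longrightarrow> {#\<one>#} \<odot> \<alpha> = \<alpha>"
  by (simp add: prod_single act_one)

lemma prod_one_right: "\<alpha> \<in> sums \<Longrightarrow> \<alpha> \<odot> {#\<one>#} = \<alpha>"
  using prod_comm[of \<alpha> "{#\<one>#}"] by (simp add: prod_one)

lemma prod_sum_distrib: "\<alpha> \<odot> (\<Sum>i\<in>I. f i) = (\<Sum>i\<in>I. \<alpha> \<odot> f i)"
  by (induction I rule: infinite_finite_induct) (auto simp: prod_add_right)

lemma neg_sums [simp]: "\<alpha> \<in> sums \<Longrightarrow> neg \<alpha> \<in> sums"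
  by (simp add: neg_def)

lemma neg_add: "neg (\<alpha> + \<beta>) = neg \<alpha> + neg \<beta>"
  by (simp add: neg_def prod_add_right)

lemma neg_empty [simp]: "neg {#} = {#}"
  by (simp add: neg_def)

lemma neg_sum: "neg (\<Sum>i\<in>I. f i) = (\<Sum>i\<in>I. neg (f i))"
  by (simp add: neg_def prod_sum_distrib)

lemma neg_neg: "\<alpha> \<in> sums \<Longrightarrow> neg (neg \<alpha>) = \<alpha>"
  by (simp add: neg_def prod_single act_act minus_one_squared act_one)

lemma prod_neg: "\<alpha> \<in> sums \<Longrightarrow> \<beta> \<in> sums \<Longrightarrow> \<alpha> \<odot> neg \<beta> = neg (\<alpha> \<odot> \<beta>)"
  by (simp add: neg_def prod_left_comm)

section \<open>Atoms and their inverses\<close>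

lemma atoms_sums [simp]: "\<alpha> \<in> atoms \<Longrightarrow> \<alpha> \<in> sums"
  unfolding atoms_def by simp

lemma atoms_empty [simp]: "{#} \<in> atoms"
  unfolding atoms_def by simp

lemma atoms_single [simp]: "{#x#} \<in> atoms \<longleftrightarrow> x \<in> nonzeros F"
  unfolding atoms_def by simp

lemma atoms_cases:
  assumes "\<alpha> \<in> atoms"
  obtains "\<alpha> = {#}" | x where "x \<in> nonzeros F" "\<alpha> = {#x#}"
proof (cases \<alpha>)
  case (add x \<beta>)
  then have "\<beta> = {#}" "x \<in> nonzeros F" using assms unfolding atoms_def by auto
  then show ?thesis using add that by blast
qed (use that in blast)

lemma atoms_prod [simp]: "\<alpha> \<in> atoms \<Longrightarrow> \<beta> \<in> atoms \<Longrightarrow> \<alpha> \<odot> \<beta> \<in> atoms"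
  by (elim atoms_cases) (auto simp: prod_single act_def)

lemma atoms_inverse:
  assumes "\<alpha> \<in> atoms" "\<alpha> \<noteq> {#}"
  obtains \<beta> where "\<beta> \<in> atoms" "\<beta> \<odot> \<alpha> = {#\<one>#}"
proof -
  obtain x where x: "x \<in> nonzeros F" "\<alpha> = {#x#}" using assms by (blast elim: atoms_cases)
  obtain y where "y \<in> nonzeros F" "y \<otimes> x = \<one>" using nonzeros_inv x(1) by blast
  then show ?thesis using that[of "{#y#}"] x by (simp add: prod_single act_def)
qed

lemma formal_atoms [simp]: "x \<in> carrier F \<Longrightarrow> formal F x \<in> atoms"
  by (auto simp: formal_def nonzeros_def)

lemma formal_empty_iff [simp]: "formal F x = {#} \<longleftrightarrow> x = tzero F"
  by (simp add: formal_def)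

lemma formal_mult:
  assumes "x \<in> carrier F" "y \<in> carrier F"
  shows "formal F (x \<otimes> y) = formal F x \<odot> formal F y"
proof (cases "x = tzero F \<or> y = tzero F")
  case True
  then show ?thesis
    using assms tzero_absorbing tzero_closed m_comm by (auto simp: formal_def)
next
  case False
  then have "x \<in> nonzeros F" "y \<in> nonzeros F" using assms by (auto simp: nonzeros_def)
  then have "x \<otimes> y \<in> nonzeros F" by simp
  then show ?thesis using False by (auto simp: formal_def nonzeros_def prod_single act_def)
qed

end

section \<open>Fusion\<close>

locale fused_tract = tract +
  assumes strongly_fused: "strongly_fused F"
begin

lemma fuse:
  assumes "\<alpha> + \<gamma> \<in> N" "\<beta> + neg \<gamma> \<in> N" "\<gamma> = {#} \<or> \<gamma> \<notin> N" "\<gamma> \<in> sums"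
  shows "\<alpha> + \<beta> \<in> N"
proof -
  have "formal_minus F \<beta> \<gamma> \<in> N" using assms by (simp add: formal_minus_def neg_def prod_single)
  moreover have "\<alpha> \<in> sums" "\<beta> \<in> sums" using null_sums[OF assms(1)] null_sums[OF assms(2)] by auto
  ultimately show ?thesis using strongly_fused assms unfolding strongly_fused_def by blast
qed

text \<open>This is the case \<gamma> = 0 of the fusion axiom. Together with \<open>T3\<close> it
  makes the null set an ideal, see \<open>null_prod\<close>.\<close>

lemma null_add: "\<alpha> \<in> N \<Longrightarrow> \<beta> \<in> N \<Longrightarrow> \<alpha> + \<beta> \<in> N"
  using fuse[of \<alpha> "{#}" \<beta>] by simp

lemma null_sum: "(\<And>i. i \<in> I \<Longrightarrow> f i \<in> N) \<Longrightarrow> (\<Sum>i\<in>I. f i) \<in> N"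
  by (induction I rule: infinite_finite_induct) (auto simp: T1 null_add)

lemma null_prod: "\<alpha> \<in> sums \<Longrightarrow> \<beta> \<in> N \<Longrightarrow> \<alpha> \<odot> \<beta> \<in> N"
  by (induction \<alpha>) (auto simp: prod_add_mset null_add T1 T3)

lemma null_neg: "\<alpha> \<in> N \<Longrightarrow> neg \<alpha> \<in> N"
  by (simp add: neg_def null_prod)

lemma null_neg_iff: "\<alpha> \<in> sums \<Longrightarrow> neg \<alpha> \<in> N \<longleftrightarrow> \<alpha> \<in> N"
  using null_neg neg_neg by metis

lemma null_prod_iff:
  assumes "\<alpha> \<in> atoms" "\<alpha> \<noteq> {#}" "\<beta> \<in> sums"
  shows "\<alpha> \<odot> \<beta> \<in> N \<longleftrightarrow> \<beta> \<in> N"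
proof
  obtain \<gamma> where \<gamma>: "\<gamma> \<in> atoms" "\<gamma> \<odot> \<alpha> = {#\<one>#}" using assms atoms_inverse by blast
  assume "\<alpha> \<odot> \<beta> \<in> N"
  then have "\<gamma> \<odot> (\<alpha> \<odot> \<beta>) \<in> N" using \<gamma> null_prod by simp
  then show "\<beta> \<in> N" using \<gamma> assms by (simp add: prod_one flip: prod_assoc)
qed (use assms null_prod in simp)

lemma null_if_one_null: "{#\<one>#} \<in> N \<Longrightarrow> \<alpha> \<in> sums \<Longrightarrow> \<alpha> \<in> N"
  using null_prod[of \<alpha> "{#\<one>#}"] by (simp add: prod_one_right)

text \<open>Nonzero atoms are invertible, so a null one would make \<one> null. Hence the side
  condition of \<open>fuse\<close> holds automatically whenever \<gamma> is an atom.\<close>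

lemma null_atom_iff: "{#\<one>#} \<notin> N \<Longrightarrow> \<alpha> \<in> atoms \<Longrightarrow> \<alpha> \<in> N \<longleftrightarrow> \<alpha> = {#}"
  using null_prod_iff[of \<alpha> "{#\<one>#}"] T1 by (auto simp: prod_one_right)

lemma fuse_plus_minus:
  assumes "\<rho> \<notin> N" "\<rho> + \<sigma> \<in> N" "\<rho> + \<tau> \<in> N"
  shows "\<sigma> + neg \<tau> \<in> N"
proof -
  have "\<rho> \<in> sums" "\<tau> \<in> sums" using null_sums[OF assms(3)] by auto
  then show ?thesis
    using fuse[of \<sigma> \<rho> "neg \<tau>"] assms null_neg[OF assms(3)] by (simp add: neg_add add.commute)
qed

text \<open>By \<open>fuse_plus_minus\<close>, \<sigma> - \<tau> is null. Fusing it along -\<tau>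
  with the null sum \<tau> - \<tau> + \<tau> gives \<sigma> + \<tau> - \<tau>, and fusing that along
  \<tau> with \<rho> + \<tau> gives the claim. The assumption \<open>idem\<close> amounts to 1 + 1 -
  1 being null.\<close>

lemma fuse_idempotent:
  assumes idem: "\<And>\<alpha>. \<alpha> \<in> sums \<Longrightarrow> \<alpha> + \<alpha> + neg \<alpha> \<in> N"
    and \<rho>: "\<rho> \<notin> N" "\<rho> + \<sigma> \<in> N" "\<rho> + \<tau> \<in> N"
  shows "\<rho> + \<sigma> + \<tau> \<in> N"
proof (cases "\<tau> \<in> N")
  case True
  then show ?thesis using null_add \<rho> by blast
next
  case False
  have s: "\<tau> \<in> sums" "neg \<tau> \<in> sums" using null_sums[OF \<rho>(3)] by auto
  have "\<tau> + neg \<tau> + neg (neg \<tau>) \<in> N"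
    using idem[OF s(1)] by (simp add: neg_neg s ac_simps)
  then have "\<sigma> + (\<tau> + neg \<tau>) \<in> N"
    using fuse[of \<sigma> "neg \<tau>" "\<tau> + neg \<tau>"] fuse_plus_minus[OF \<rho>] False s null_neg_iff by blast
  then show ?thesis
    using fuse[of \<rho> \<tau> "\<sigma> + \<tau>"] \<rho> False s by (simp add: ac_simps)
qed

section \<open>Families that become null when any one term is left out\<close>

text \<open>\<open>A\<close> is a nonempty set of least cardinality whose complement has a non-null
  sum; \<open>S - {e}\<close> is a candidate. It has at least two elements because leaving out a
  single term gives a null sum.\<close>

lemma maximal_nonnull_part:
  assumes "finite S" "\<And>b. b \<in> S \<Longrightarrow> sum s (S - {b}) \<in> N" "e \<in> S" "s e \<notin> N" "S \<noteq> {e}"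
  obtains A a b where "A \<subseteq> S" "a \<in> A" "b \<in> A" "a \<noteq> b" "sum s (S - A) \<notin> N"
    "\<And>B. B \<subset> A \<Longrightarrow> B \<noteq> {} \<Longrightarrow> sum s (S - B) \<in> N"
proof -
  let ?P = "\<lambda>A. A \<subseteq> S \<and> A \<noteq> {} \<and> sum s (S - A) \<notin> N"
  have "S - (S - {e}) = {e}" using assms(3) by blast
  then have n: "sum s (S - (S - {e})) \<notin> N" using assms(4) by simp
  have "?P (S - {e})" using n assms(3,5) by auto
  then obtain A where A: "?P A" "\<And>B. ?P B \<Longrightarrow> card A \<le> card B"
    using ex_has_least_nat[of ?P _ card] by metis
  obtain a where a: "a \<in> A" using A by blast
  then have "A \<noteq> {a}" using A assms(2) by blast
  then obtain b where "b \<in> A" "a \<noteq> b" using a by blast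
  moreover have "sum s (S - B) \<in> N" if "B \<subset> A" "B \<noteq> {}" for B
    using A that psubset_card_mono[of A B] finite_subset[OF _ assms(1)]
    by (metis leD psubset_imp_subset subset_trans)
  ultimately show ?thesis using that A(1) a by blast
qed

text \<open>Let \<rho> be a maximal non-null partial sum missing \<open>a\<close> and
  \<open>b\<close>. Adding either or both of \<open>t a\<close>, \<open>t b\<close> to \<rho> gives
  null sums. Fusing along \<rho> makes \<open>t a\<close> + \<open>t b\<close> - \<open>t a\<close>
  and \<open>t a\<close> - \<open>t b\<close> null, and fusing these along \<open>t b\<close> makes
  \<open>t a\<close> + \<open>t a\<close> - \<open>t a\<close> null. Dividing by the atom
  \<open>t a\<close> leaves 1 + 1 - 1.\<close>

lemma idempotent_if_leave_one_out:
  assumes "finite S" "sum t S \<in> N" "\<And>b. b \<in> S \<Longrightarrow> sum t (S - {b}) \<in> N"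
    and t: "\<And>b. b \<in> S \<Longrightarrow> t b \<in> atoms" and e: "e \<in> S" "t e \<notin> N"
    and \<alpha>: "\<alpha> \<in> sums"
  shows "\<alpha> + \<alpha> + neg \<alpha> \<in> N"
proof -
  have "S \<noteq> {e}" using assms(2) e by auto
  then obtain A a b where A: "A \<subseteq> S" "a \<in> A" "b \<in> A" "a \<noteq> b" "sum t (S - A) \<notin> N"
    and B: "\<And>B. B \<subset> A \<Longrightarrow> B \<noteq> {} \<Longrightarrow> sum t (S - B) \<in> N"
    using maximal_nonnull_part[of S t e] assms by blast
  let ?\<rho> = "sum t (S - A)"
  have part: "sum t (S - (A - C)) = ?\<rho> + sum t C" if "C \<subseteq> A" for C
  proof -
    have "S - (A - C) = (S - A) \<union> C" "(S - A) \<inter> C = {}" using A(1) that by auto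
    then show ?thesis
      using assms(1) A(1) that by (simp add: sum.union_disjoint finite_subset)
  qed
  have null: "sum t (S - (A - C)) \<in> N" if "C \<subseteq> A" "C \<noteq> {}" for C
  \<comment> \<open>For \<open>C = A\<close> nothing is left out, and the assumption that the full
    sum is null takes over from minimality of \<open>A\<close>.\<close>
  proof (cases "A - C = {}")
    case False
    then show ?thesis using B that by blast
  next
    case True
    then show ?thesis using assms(2) by (simp only: Diff_empty)
  qed
  have a: "?\<rho> + t a \<in> N" and b: "?\<rho> + t b \<in> N" and ab: "?\<rho> + (t a + t b) \<in> N"
    using part[of "{a}"] null[of "{a}"] part[of "{b}"] null[of "{b}"]
      part[of "{a, b}"] null[of "{a, b}"] A by auto
  have ta: "t a \<in> atoms" "t b \<in> atoms" using t A by auto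
  have "t a + t b + neg (t a) \<in> N" using fuse_plus_minus[OF A(5) ab a] .
  moreover have "t a + neg (t b) \<in> N" using fuse_plus_minus[OF A(5) a b] .
  \<comment> \<open>The non-null atom \<open>t e\<close> shows that \<one> is not null, so no
    nonzero atom is null.\<close>
  moreover have "t b \<notin> N"
  proof -
    have "t b \<noteq> {#}" using b A(5) by auto
    moreover have "t e \<noteq> {#}" using e T1 by auto
    ultimately show ?thesis
      using null_prod_iff[of "t e" "{#\<one>#}"] null_prod_iff[of "t b" "{#\<one>#}"] e t ta
      by (simp add: prod_one_right)
  qed
  ultimately have "t a + neg (t a) + t a \<in> N"
    using fuse[of "t a + neg (t a)" "t b" "t a"] ta by (simp add: ac_simps)
  moreover have "t a + neg (t a) + t a = t a \<odot> ({#\<one>#} + {#\<one>#} + neg {#\<one>#})"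
    unfolding prod_add_right using ta by (simp add: prod_neg prod_one_right ac_simps)
  moreover have "t a \<noteq> {#}" using a A(5) by auto
  ultimately have "{#\<one>#} + {#\<one>#} + neg {#\<one>#} \<in> N"
    using ta(1) null_prod_iff[of "t a" "{#\<one>#} + {#\<one>#} + neg {#\<one>#}"] by simp
  then have "\<alpha> \<odot> ({#\<one>#} + {#\<one>#} + neg {#\<one>#}) \<in> N" using \<alpha> null_prod by blast
  moreover have "\<alpha> \<odot> ({#\<one>#} + {#\<one>#} + neg {#\<one>#}) = \<alpha> + \<alpha> + neg \<alpha>"
    unfolding prod_add_right using \<alpha> by (simp add: prod_neg prod_one_right)
  ultimately show ?thesis by simp
qed

text \<open>Starting from a maximal non-null partial sum \<rho>, each single missing term completes
  \<rho> to a null sum. \<open>fuse_idempotent\<close> collects the missing terms one by one until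
  the full sum is reached. Singletons are excluded since for them the leave-one-out condition only
  concerns the empty sum.\<close>

lemma null_if_leave_one_out:
  assumes idem: "\<And>\<alpha>. \<alpha> \<in> sums \<Longrightarrow> \<alpha> + \<alpha> + neg \<alpha> \<in> N"
    and S: "finite S" "\<And>b. b \<in> S \<Longrightarrow> sum s (S - {b}) \<in> N" "\<And>e. S \<noteq> {e}"
  shows "sum s S \<in> N"
proof (cases "\<forall>e\<in>S. s e \<in> N")
  case True
  then show ?thesis by (simp add: null_sum)
next
  case False
  then obtain e where "e \<in> S" "s e \<notin> N" by blast
  then obtain A a b where A: "A \<subseteq> S" "a \<in> A" "b \<in> A" "a \<noteq> b" "sum s (S - A) \<notin> N"
    and B: "\<And>B. B \<subset> A \<Longrightarrow> B \<noteq> {} \<Longrightarrow> sum s (S - B) \<in> N"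
    using maximal_nonnull_part[of S s e] S by blast
  let ?\<rho> = "sum s (S - A)"
  have fin: "finite A" using S(1) A(1) finite_subset by blast
  have one: "?\<rho> + s c \<in> N" if "c \<in> A" for c
  proof -
    have "A - {c} \<noteq> {}" using A that by auto
    moreover have "S - (A - {c}) = insert c (S - A)" using that A(1) by auto
    ultimately show ?thesis
      using B[of "A - {c}"] that S(1) by (auto simp: add.commute)
  qed
  have "C \<noteq> {} \<Longrightarrow> C \<subseteq> A \<Longrightarrow> ?\<rho> + sum s C \<in> N" if "finite C" for C
    using that
  proof (induction C rule: finite_induct)
    case (insert c C)
    show ?case
    proof (cases "C = {}")
      case False
      then show ?thesis
        using fuse_idempotent[of ?\<rho> "sum s C" "s c"] idem A(5) one[of c] insert
        by (simp add: ac_simps)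
    qed (use insert one in simp)
  qed simp
  then have "?\<rho> + sum s A \<in> N" using fin A(2) by blast
  then show ?thesis using S(1) A(1) by (simp add: sum.subset_diff[of A S])
qed

section \<open>Orthogonality of vectors and covectors\<close>

text \<open>
  The set \<open>J\<close> plays the role of the elements contracted so far: \<open>x\<close> restricts to a vector and
  \<open>y\<close> to a covector of the contraction by \<open>J\<close>. Letting \<open>y\<close> take formal sums as values makes it
  possible to eliminate a coordinate of \<open>y\<close> term by term.
\<close>

lemma null_pairing:
  fixes E :: "'e set" and CC DD :: "('e \<Rightarrow> 'a multiset) set"
  assumes E: "finite E"
    and C: "\<And>c e. c \<in> CC \<Longrightarrow> e \<in> E \<Longrightarrow> c e \<in> atoms"
    and D: "\<And>d e. d \<in> DD \<Longrightarrow> e \<in> E \<Longrightarrow> d e \<in> atoms"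
    and CD: "\<And>c d. c \<in> CC \<Longrightarrow> d \<in> DD \<Longrightarrow> (\<Sum>e\<in>E. c e \<odot> d e) \<in> N"
    and dichotomy: "\<And>J e. J \<subseteq> E \<Longrightarrow> e \<in> E - J \<Longrightarrow>
      (\<exists>c\<in>CC. c e \<noteq> {#} \<and> (\<forall>f\<in>E - J - {e}. c f = {#})) \<or>
      (\<exists>d\<in>DD. d e \<noteq> {#} \<and> (\<forall>f\<in>J. d f = {#}))"
    and J: "J \<subseteq> E"
    and x: "\<And>e. e \<in> E \<Longrightarrow> x e \<in> atoms"
      "\<And>d. d \<in> DD \<Longrightarrow> (\<forall>f\<in>J. d f = {#}) \<Longrightarrow> (\<Sum>e\<in>E. x e \<odot> d e) \<in> N"
    and y: "\<And>e. e \<in> E \<Longrightarrow> y e \<in> sums" "\<And>e. e \<in> J \<Longrightarrow> y e = {#}"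
      "\<And>c. c \<in> CC \<Longrightarrow> (\<Sum>e\<in>E. c e \<odot> y e) \<in> N"
  shows "(\<Sum>e\<in>E. x e \<odot> y e) \<in> N"
  using J x y
\<comment> \<open>Both adding \<open>b\<close> to \<open>J\<close> and setting \<open>x b\<close> to
  zero lower this cardinality.\<close>
proof (induction "card {e \<in> E - J. x e \<noteq> {#}}" arbitrary: J x y rule: less_induct)
  case less
  note J = less.prems(1) and x = less.prems(2,3) and y0 = less.prems(4-6)
  let ?S = "{e \<in> E - J. x e \<noteq> {#}}"
  have finS: "finite ?S" using E by simp
  show ?case
  proof (cases "\<exists>b\<in>?S. \<exists>d\<in>DD. (\<forall>f\<in>J. d f = {#}) \<and> d b \<noteq> {#} \<and> (\<Sum>e\<in>E - {b}. x e \<odot> d e) \<notin> N")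
    case True
    then obtain b d where b: "b \<in> E" "b \<notin> J" "x b \<noteq> {#}" and d: "d \<in> DD" "\<forall>f\<in>J. d f = {#}" "d b \<noteq> {#}"
      and nonnull: "(\<Sum>e\<in>E - {b}. x e \<odot> d e) \<notin> N"
      by blast
    have split: "sum g E = sum g (E - {b}) + g b" for g :: "'e \<Rightarrow> 'a multiset"
      using E b(1) by (simp add: sum.remove add.commute)
    note [simp] = D[OF d(1)] x(1) b(1)
    have xd_sums [simp]: "(\<Sum>e\<in>E - {b}. x e \<odot> d e) \<in> sums" by (rule sums_sum) auto
    have nondegenerate: "{#\<one>#} \<notin> N" using null_if_one_null[OF _ xd_sums] nonnull by blast
    show ?thesis using y0
    proof (induction "size (y b)" arbitrary: y)
      case 0
      have yb: "y b = {#}" using 0(1) by simp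
      \<comment> \<open>Now \<open>y\<close> also vanishes at \<open>b\<close>, and \<open>x\<close>
        is tested against fewer members of \<open>DD\<close>, so the outer hypothesis applies to
        \<open>insert b J\<close>.\<close>
      have "{e \<in> E - insert b J. x e \<noteq> {#}} \<subset> ?S" using b by blast
      then have "card {e \<in> E - insert b J. x e \<noteq> {#}} < card ?S" using finS psubset_card_mono by blast
      then show ?case by (rule less.hyps) (use J x 0 yb in auto)
    next
      case (Suc n)
      then obtain u v where uv: "y b = add_mset u v" by (metis size_eq_Suc_imp_eq_union)
      have "u \<in> nonzeros F" and [simp]: "v \<in> sums" using Suc.prems(1)[of b] uv by auto
      obtain w' where w': "w' \<in> atoms" "w' \<odot> d b = {#\<one>#}" using atoms_inverse d(3) by (metis D b(1) d(1))
      \<comment> \<open>\<open>w\<close> rescales \<open>d\<close> so that its value at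
        \<open>b\<close> is the term \<open>u\<close> to be removed from \<open>y b\<close>.\<close>
      define w where "w = {#u#} \<odot> w'"
      have w [simp]: "w \<in> atoms" and wd: "w \<odot> d b = {#u#}"
        using w' \<open>u \<in> nonzeros F\<close> prod_comm[of "{#u#}" "{#\<one>#}"]
        by (auto simp: w_def prod_assoc prod_one)
      have "w \<noteq> {#}" using wd by auto
      note [simp] = Suc.prems(1)
      \<comment> \<open>Subtracting \<open>w\<close> times \<open>d\<close> literally would leave
        \<open>u\<close> - \<open>u\<close> + \<open>v\<close> at \<open>b\<close>, in which formal
        terms do not cancel. The value there is therefore set to \<open>v\<close>, and fusion has to
        justify the cancellation.\<close>
      define y' where "y' f = (if f = b then v else y f + neg (w \<odot> d f))" for f
      have y'_sums: "y' e \<in> sums" if "e \<in> E" for e using that by (simp add: y'_def)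
      have "(\<Sum>e\<in>E. c e \<odot> y' e) \<in> N" if c: "c \<in> CC" for c
      proof -
        note [simp] = C[OF c]
        let ?\<alpha> = "(\<Sum>e\<in>E - {b}. c e \<odot> y e) + c b \<odot> v"
        let ?\<beta> = "neg (w \<odot> (\<Sum>e\<in>E - {b}. c e \<odot> d e))"
        let ?\<gamma> = "w \<odot> (c b \<odot> d b)"
        have \<gamma>: "?\<gamma> = c b \<odot> {#u#}" using prod_left_comm[of w "c b" "d b"] by (simp add: wd)
        have "?\<alpha> + ?\<gamma> = (\<Sum>e\<in>E. c e \<odot> y e)"
          unfolding \<gamma> split uv using prod_add_right[of "c b" "{#u#}" v] by simp
        moreover have "?\<beta> + neg ?\<gamma> = neg (w \<odot> (\<Sum>e\<in>E. c e \<odot> d e))"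
          unfolding split by (simp add: neg_add prod_add_right)
        \<comment> \<open>Since \<open>c\<close> and \<open>d\<close> are atom-valued, the cancelled
          term is an atom.\<close>
        moreover have "?\<gamma> = {#} \<or> ?\<gamma> \<notin> N"
          using null_atom_iff[OF nondegenerate, of ?\<gamma>] by simp
        moreover have "?\<alpha> + ?\<beta> = (\<Sum>e\<in>E. c e \<odot> y' e)"
        proof -
          have "(\<Sum>e\<in>E - {b}. c e \<odot> y' e) = (\<Sum>e\<in>E - {b}. c e \<odot> y e + neg (w \<odot> (c e \<odot> d e)))"
            by (rule sum.cong) (auto simp: y'_def prod_add_right prod_neg prod_left_comm)
          then show ?thesis
            unfolding split by (simp add: y'_def sum.distrib neg_sum prod_sum_distrib)
        qed
        ultimately show ?thesis
          using fuse[of ?\<alpha> ?\<gamma> ?\<beta>] Suc.prems(3)[OF c] null_neg null_prod[of w] CD[OF c d(1)] by simp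
      qed
      moreover have "y' e = {#}" if "e \<in> J" for e
        using that Suc.prems(2) d(2) b(2) by (auto simp: y'_def)
      moreover have "n = size (y' b)" using Suc.hyps(2) uv by (simp add: y'_def)
      ultimately have xy': "(\<Sum>e\<in>E. x e \<odot> y' e) \<in> N"
        using Suc.hyps(1)[of y'] y'_sums by blast
      \<comment> \<open>The fusion now runs backwards: the pairing with \<open>y'\<close> is
        \<open>?\<alpha>\<close> - \<open>?z\<close>, and \<open>?\<beta>\<close> +
        \<open>?z\<close> is \<open>w\<close> times the null pairing of \<open>x\<close> with
        \<open>d\<close>. As \<open>?z\<close> is non-null by the choice of \<open>b\<close> and
        \<open>d\<close>, fusing along -\<open>?z\<close> restores the term of
        \<open>u\<close>.\<close>
      let ?\<alpha> = "(\<Sum>e\<in>E - {b}. x e \<odot> y e) + x b \<odot> v"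
      let ?z = "w \<odot> (\<Sum>e\<in>E - {b}. x e \<odot> d e)"
      let ?\<beta> = "w \<odot> (x b \<odot> d b)"
      have [simp]: "?z \<in> sums" by simp
      have "(\<Sum>e\<in>E - {b}. x e \<odot> y' e) = (\<Sum>e\<in>E - {b}. x e \<odot> y e + neg (w \<odot> (x e \<odot> d e)))"
        by (rule sum.cong) (auto simp: y'_def prod_add_right prod_neg prod_left_comm)
      then have "?\<alpha> + neg ?z = (\<Sum>e\<in>E. x e \<odot> y' e)"
        unfolding split by (simp add: y'_def sum.distrib neg_sum prod_sum_distrib)
      moreover have "?\<beta> + neg (neg ?z) = w \<odot> (\<Sum>e\<in>E. x e \<odot> d e)"
        unfolding split by (simp add: neg_neg prod_add_right)
      moreover have "w \<odot> (\<Sum>e\<in>E. x e \<odot> d e) \<in> N"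
        using null_prod[of w] x(2)[OF d(1,2)] by simp
      moreover have "neg ?z \<notin> N"
        using null_neg_iff[of ?z] null_prod_iff[OF w \<open>w \<noteq> {#}\<close> xd_sums] nonnull by simp
      moreover have "?\<alpha> + ?\<beta> = (\<Sum>e\<in>E. x e \<odot> y e)"
      proof -
        have "?\<beta> = x b \<odot> {#u#}" using prod_left_comm[of w "x b" "d b"] by (simp add: wd)
        then show ?thesis unfolding split uv using prod_add_right[of "x b" "{#u#}" v] by simp
      qed
      ultimately show ?case using fuse[of ?\<alpha> "neg ?z" ?\<beta>] xy' by simp
    qed
  next
    case False
    have restrict: "(\<Sum>e\<in>E. (x(b := {#})) e \<odot> g e) = (\<Sum>e\<in>E - {b}. x e \<odot> g e)" if "b \<in> E" for b g
      using E that by (subst sum.remove) (auto intro: sum.cong)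
    have leave_out: "(\<Sum>e\<in>E - {b}. x e \<odot> d e) \<in> N" if "b \<in> ?S" "d \<in> DD" "\<forall>f\<in>J. d f = {#}" for b d
    proof (cases "d b = {#}")
      case True
      then show ?thesis using x(2)[OF that(2,3)] E that(1) sum.remove[of E b "\<lambda>e. x e \<odot> d e"] by simp
    qed (use False that in blast)
    \<comment> \<open>By \<open>leave_out\<close>, setting \<open>x b\<close> to zero keeps
      \<open>x\<close> orthogonal to every \<open>d\<close> vanishing on \<open>J\<close>, so the
      induction hypothesis applies to the smaller support.\<close>
    have leave_out_y: "(\<Sum>e\<in>E - {b}. x e \<odot> y e) \<in> N" if b: "b \<in> ?S" for b
    proof -
      have "{e \<in> E - J. (x(b := {#})) e \<noteq> {#}} \<subset> ?S" using b by auto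
      then have card: "card {e \<in> E - J. (x(b := {#})) e \<noteq> {#}} < card ?S"
        using finS psubset_card_mono by blast
      have bE: "b \<in> E" using b by simp
      have "(\<Sum>e\<in>E. (x(b := {#})) e \<odot> y e) \<in> N"
      proof (rule less.hyps[OF card J])
        show "(x(b := {#})) e \<in> atoms" if "e \<in> E" for e using x(1) that by simp
        show "(\<Sum>e\<in>E. (x(b := {#})) e \<odot> d e) \<in> N" if "d \<in> DD" "\<forall>f\<in>J. d f = {#}" for d
          unfolding restrict[OF bE] using leave_out[OF b that] .
      qed (use y0 in auto)
      then show ?thesis unfolding restrict[OF bE] .
    qed
    have on_S: "(\<Sum>e\<in>?S - B. x e \<odot> g e) = (\<Sum>e\<in>E - B. x e \<odot> g e)" if "\<forall>f\<in>J. g f = {#}" for g B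
      using E that by (intro sum.mono_neutral_left) auto
    show ?thesis
    proof (cases "\<exists>e\<in>?S. \<exists>d\<in>DD. (\<forall>f\<in>J. d f = {#}) \<and> x e \<odot> d e \<notin> N")
      case True
      then obtain e d where e: "e \<in> ?S" and d: "d \<in> DD" "\<forall>f\<in>J. d f = {#}" and ed: "x e \<odot> d e \<notin> N"
        by blast
      have xd: "(\<Sum>e\<in>?S. x e \<odot> d e) \<in> N" using x(2)[OF d] on_S[OF d(2), of "{}"] by simp
      have idem: "\<alpha> + \<alpha> + neg \<alpha> \<in> N" if "\<alpha> \<in> sums" for \<alpha>
      proof (rule idempotent_if_leave_one_out[OF finS xd _ _ e ed that])
        show "(\<Sum>e\<in>?S - {b}. x e \<odot> d e) \<in> N" if "b \<in> ?S" for b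
          unfolding on_S[OF d(2)] using leave_out[OF that d] .
        show "x b \<odot> d b \<in> atoms" if "b \<in> ?S" for b using that x(1) D[OF d(1)] by simp
      qed
      have "?S \<noteq> {f}" for f
      proof
        assume "?S = {f}"
        then show False using xd e ed by simp
      qed
      moreover have "(\<Sum>e\<in>?S - {b}. x e \<odot> y e) \<in> N" if "b \<in> ?S" for b
        using leave_out_y[OF that] on_S[of y] y0(2) by simp
      ultimately have "(\<Sum>e\<in>?S. x e \<odot> y e) \<in> N"
        using null_if_leave_one_out[OF idem finS, of "\<lambda>e. x e \<odot> y e"] by blast
      then show ?thesis using on_S[of y "{}"] y0(2) by simp
    next
      case loops: False
      have "x e \<odot> y e \<in> N" if e: "e \<in> ?S" for e
      proof (cases "{#\<one>#} \<in> N")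
        case True
        then show ?thesis using null_if_one_null e x(1) y0(1) by simp
      next
        case False
        \<comment> \<open>Thus \<open>e\<close> is a loop of the contraction by \<open>J\<close>,
          and \<open>dichotomy\<close> yields a \<open>c\<close> supported in
          \<open>insert e J\<close>. As \<open>y\<close> vanishes on \<open>J\<close>, the pairing
          of \<open>c\<close> with \<open>y\<close> is its single term at \<open>e\<close>, which
          makes \<open>y e\<close> null.\<close>
        have "d e = {#}" if "d \<in> DD" "\<forall>f\<in>J. d f = {#}" for d
          using loops that e null_prod_iff[of "x e" "d e"] null_atom_iff[OF False, of "d e"] x(1) D
          by auto
        then obtain c where c: "c \<in> CC" "c e \<noteq> {#}" "\<forall>f\<in>E - J - {e}. c f = {#}"
          using dichotomy[OF J, of e] e by blast
        have "c f \<odot> y f = {#}" if "f \<in> E - {e}" for f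
          using that c(3) y0(2) by (cases "f \<in> J") auto
        then have "(\<Sum>f\<in>{e}. c f \<odot> y f) = (\<Sum>f\<in>E. c f \<odot> y f)"
          using E e by (intro sum.mono_neutral_left) auto
        then have "y e \<in> N"
          using null_prod_iff[of "c e" "y e"] C[OF c(1)] c(2) y0(1,3) c(1) e by simp
        then show ?thesis using null_prod e x(1) by simp
      qed
      then have "(\<Sum>e\<in>?S. x e \<odot> y e) \<in> N" by (rule null_sum)
      then show ?thesis using on_S[of y "{}"] y0(2) by simp
    qed
  qed
qed

end

section \<open>From tract-valued signatures to atom-valued functions\<close>

context tract
begin

lemma supp_scale:
  assumes "c \<in> nonzeros F" "X \<in> E \<rightarrow> carrier F"
  shows "supp F E (scale F E c X) = supp F E X"
proof -
  have "c \<otimes> X e = tzero F \<longleftrightarrow> X e = tzero F" if "e \<in> E" for e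
  proof (cases "X e = tzero F")
    case True
    then show ?thesis using assms(1) tzero_absorbing by (simp add: nonzeros_def)
  next
    case False
    then have "X e \<in> nonzeros F" using assms(2) that by (auto simp: nonzeros_def)
    then have "c \<otimes> X e \<in> nonzeros F" using assms(1) by simp
    then show ?thesis using False by (simp add: nonzeros_def)
  qed
  then show ?thesis by (auto simp: supp_def scale_def)
qed

text \<open>This is surjectivity of the support bijection: by \<open>supp_scale\<close> a projective
  class has a single support, which \<open>the_elem\<close> extracts.\<close>

lemma signature_circuit:
  assumes C: "F_signature F E I C" and K: "K \<in> circuits E I"
  obtains X where "X \<in> C" "supp F E X = K"
proof -
  have "K \<in> (\<lambda>P. the_elem (supp F E ` P)) ` projectivization F E C"
    using C K by (auto simp: F_signature_def bij_betw_def)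
  then obtain X where X: "X \<in> C"
      "K = the_elem (supp F E ` ((\<lambda>c. scale F E c X) ` nonzeros F))"
    by (auto simp: projectivization_def)
  have "X \<in> E \<rightarrow> carrier F" using C X(1) by (auto simp: F_signature_def PiE_def)
  then have "supp F E ` ((\<lambda>c. scale F E c X) ` nonzeros F) = (\<lambda>_. supp F E X) ` nonzeros F"
    by (simp add: image_image supp_scale cong: image_cong_simp)
  also have "\<dots> = {supp F E X}" using nonzeros_one by blast
  finally have "supp F E ` ((\<lambda>c. scale F E c X) ` nonzeros F) = {supp F E X}" .
  then show ?thesis using that X by simp
qed

lemma signature_values: "F_signature F E I C \<Longrightarrow> X \<in> C \<Longrightarrow> e \<in> E \<Longrightarrow> X e \<in> carrier F"
  by (auto simp: F_signature_def)

text \<open>A morphism is a homomorphism on nonzero elements only; absorption extends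
  multiplicativity to zero.\<close>

lemma
  assumes "tract_involution F bar"
  shows involution_closed: "x \<in> carrier F \<Longrightarrow> bar x \<in> carrier F"
    and involution_zero_iff: "x \<in> carrier F \<Longrightarrow> bar x = tzero F \<longleftrightarrow> x = tzero F"
    and involution_mult: "x \<in> carrier F \<Longrightarrow> y \<in> carrier F \<Longrightarrow> bar (x \<otimes> y) = bar x \<otimes> bar y"
    and involution_involution: "x \<in> carrier F \<Longrightarrow> bar (bar x) = x"
    and involution_null: "\<alpha> \<in> N \<Longrightarrow> image_mset bar \<alpha> \<in> N"
proof -
  have bar: "bar (tzero F) = tzero F" "\<And>x. x \<in> nonzeros F \<Longrightarrow> bar x \<in> nonzeros F"
      "\<And>x y. x \<in> nonzeros F \<Longrightarrow> y \<in> nonzeros F \<Longrightarrow> bar (x \<otimes> y) = bar x \<otimes> bar y"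
    using assms by (auto simp: tract_involution_def tract_morphism_def hom_def mult_group_def)
  show "x \<in> carrier F \<Longrightarrow> bar (bar x) = x" "\<alpha> \<in> N \<Longrightarrow> image_mset bar \<alpha> \<in> N"
    using assms by (auto simp: tract_involution_def tract_morphism_def)
  show closed: "bar x \<in> carrier F" if "x \<in> carrier F" for x
    using bar that tzero_closed by (cases "x = tzero F") (auto simp: nonzeros_def)
  show "x \<in> carrier F \<Longrightarrow> bar x = tzero F \<longleftrightarrow> x = tzero F"
    using bar by (cases "x = tzero F") (auto simp: nonzeros_def)
  assume xy: "x \<in> carrier F" "y \<in> carrier F"
  show "bar (x \<otimes> y) = bar x \<otimes> bar y"
  proof (cases "x = tzero F \<or> y = tzero F")
    case True
    have zero: "z \<otimes> tzero F = tzero F" "tzero F \<otimes> z = tzero F" if "z \<in> carrier F" for z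
      using that tzero_absorbing m_comm[OF tzero_closed that] by simp_all
    show ?thesis using True
    proof
      assume "x = tzero F"
      then show ?thesis using xy(2) closed[OF xy(2)] bar(1) zero(2) by simp
    next
      assume "y = tzero F"
      then show ?thesis using xy(1) closed[OF xy(1)] bar(1) zero(1) by simp
    qed
  next
    case False
    then show ?thesis using bar(3) xy by (simp add: nonzeros_def)
  qed
qed

lemma dot_eq_sum:
  assumes "tract_involution F bar" "\<And>e. e \<in> E \<Longrightarrow> X e \<in> carrier F" "\<And>e. e \<in> E \<Longrightarrow> Y e \<in> carrier F"
  shows "dot F bar E X Y = (\<Sum>e\<in>E. formal F (X e) \<odot> formal F (bar (Y e)))"
  unfolding dot_def using assms involution_closed by (intro sum.cong) (auto simp: formal_mult)

text \<open>The involution exchanges the two pairings term by term and preserves the null set.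
  Covectors are defined with the circuit as second factor, whereas \<open>null_pairing\<close> has
  it as first.\<close>

lemma orthogonal_sym:
  assumes bar: "tract_involution F bar"
    and X: "\<And>e. e \<in> E \<Longrightarrow> X e \<in> carrier F" and Y: "\<And>e. e \<in> E \<Longrightarrow> Y e \<in> carrier F"
    and orth: "orthogonal F bar E X Y"
  shows "orthogonal F bar E Y X"
proof -
  have image: "image_mset bar (\<Sum>e\<in>A. g e) = (\<Sum>e\<in>A. image_mset bar (g e))"
    for A :: "'b set" and g :: "'b \<Rightarrow> 'a multiset"
    by (induction A rule: infinite_finite_induct) auto
  have "image_mset bar (formal F (X e \<otimes> bar (Y e))) = formal F (Y e \<otimes> bar (X e))" if "e \<in> E" for e
  proof -
    note [simp] = X[OF that] Y[OF that] involution_closed[OF bar]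
    have "image_mset bar (formal F z) = formal F (bar z)" if "z \<in> carrier F" for z
      using that involution_zero_iff[OF bar] by (simp add: formal_def)
    then show ?thesis
      by (simp add: involution_mult[OF bar] involution_involution[OF bar] m_comm)
  qed
  then have "image_mset bar (dot F bar E X Y) = dot F bar E Y X"
    unfolding dot_def image by (intro sum.cong) auto
  then show ?thesis using involution_null[OF bar] orth by (metis orthogonal_def)
qed

end

theorem theorem1p11:
  fixes F :: "'a tract" and bar :: "'a \<Rightarrow> 'a"
  assumes "tract F"
    and "tract_involution F bar"
    and "strongly_fused F"
  shows "perfect TYPE('e) F bar"
  unfolding perfect_def orthogonal_sets_def
proof (intro allI impI ballI)
  interpret fused_tract F using assms by (simp add: fused_tract_def fused_tract_axioms_def)
  note bar = assms(2)
  fix M :: "('a, 'e) F_matroid" and X Y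
  assume M: "F_matroid F bar M" and X: "X \<in> vectors F bar M" and Y: "Y \<in> covectors F bar M"
  define E I C D where "E = ground M" and "I = independents M"
    and "C = F_circuits M" and "D = F_cocircuits M"
  note E_def [symmetric, simp] I_def [symmetric, simp] C_def [symmetric, simp] D_def [symmetric, simp]
  interpret matroid E I using M by (simp add: F_matroid_def)
  have sign: "F_signature F E I C" "F_signature F E (dual_indep E I) D" "orthogonal_sets F bar E C D"
    using M by (auto simp: F_matroid_def dual_pair_def)
  note C = signature_values[OF sign(1)] and D = signature_values[OF sign(2)]
  have XE: "\<And>e. e \<in> E \<Longrightarrow> X e \<in> carrier F" and XD: "\<And>d. d \<in> D \<Longrightarrow> orthogonal F bar E X d"
    using X by (auto simp: vectors_def)
  have YE: "\<And>e. e \<in> E \<Longrightarrow> Y e \<in> carrier F" and "\<And>c. c \<in> C \<Longrightarrow> orthogonal F bar E Y c"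
    using Y by (auto simp: covectors_def)
  then have YC: "orthogonal F bar E c Y" if "c \<in> C" for c
    using orthogonal_sym[OF bar, of E Y c] C that by blast
  note [simp] = involution_closed[OF bar]
  \<comment> \<open>The involution is absorbed into the second factor, which turns the pairing into
    the bilinear one of \<open>null_pairing\<close>.\<close>
  let ?x = "\<lambda>X e. formal F (X e)" and ?y = "\<lambda>Y e. formal F (bar (Y e))"
  have orth: "(\<Sum>e\<in>E. ?x Z e \<odot> ?y W e) \<in> N \<longleftrightarrow> orthogonal F bar E Z W"
    if "\<And>e. e \<in> E \<Longrightarrow> Z e \<in> carrier F" "\<And>e. e \<in> E \<Longrightarrow> W e \<in> carrier F" for Z W
    using dot_eq_sum[OF bar, of E Z W] that by (simp add: orthogonal_def)
  have "(\<Sum>e\<in>E. ?x X e \<odot> ?y Y e) \<in> N"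
  proof (rule null_pairing[where CC = "?x ` C" and DD = "?y ` D" and J = "{}"])
    fix J e
    assume J: "J \<subseteq> E" "e \<in> E - J"
    from circuit_or_cocircuit_through[OF this]
    show "(\<exists>c\<in>?x ` C. c e \<noteq> {#} \<and> (\<forall>f\<in>E - J - {e}. c f = {#})) \<or>
      (\<exists>d\<in>?y ` D. d e \<noteq> {#} \<and> (\<forall>f\<in>J. d f = {#}))"
    proof (elim disjE bexE conjE)
      fix K assume K: "K \<in> circuits E I" "e \<in> K" "K \<subseteq> insert e J"
      then obtain c where "c \<in> C" "supp F E c = K" using signature_circuit[OF sign(1)] by blast
      then show ?thesis using K by (intro disjI1 bexI[of _ "?x c"]) (auto simp: supp_def)
    next
      fix K assume K: "K \<in> circuits E (dual_indep E I)" "e \<in> K" "K \<inter> J = {}"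
      then obtain d where "d \<in> D" "supp F E d = K" using signature_circuit[OF sign(2)] by blast
      moreover have "bar (d f) = tzero F \<longleftrightarrow> f \<notin> K" if "f \<in> E" for f
        using that calculation D[of d f] involution_zero_iff[OF bar] by (auto simp: supp_def)
      ultimately show ?thesis
        using K J by (intro disjI2 bexI[of _ "?y d"]) auto
    qed
  qed (use finite_ground sign C D XE XD YE YC orth in \<open>auto simp: orthogonal_sets_def\<close>)
  then show "orthogonal F bar (ground M) X Y" using orth[OF XE YE] by simp
qed

end
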